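(* Let $f:\mathbb{R}^n\to\mathbb{R}$ be continuously differentiable, with gradient $g=\nabla f$ Lipschitz continuous with constant $L\ge0$ (that is, $\|g(x)-g(y)\|\le L\|x-y\|$ for all $x,y\in\mathbb{R}^n$), and suppose there is a constant $f_{\rm low}$ with $f(x)\ge f_{\rm low}$ for all $x\in\mathbb{R}^n$. Let $0<\nu\le\mu<1$, $\theta>0$ and $\varsigma_i\in(0,1]$ for $i\in\{1,\dots,n\}$, and set $\varsigma_{\min}=\min_{i}\varsigma_i$. Let $\{x_k\}_{k\ge0}$ be generated by the ASTR1 algorithm (with constants $\kappa_B\ge1$, $\tau\in(0,1]$) applied to $f$, with scaling factors satisfying, for all $i\in\{1,\dots,n\}$ and all $k\ge0$, $$\theta\max[\varsigma_i,v_{i,k}]\,(k+1)^\nu\le w_{i,k}\le\theta\max[\varsigma_i,v_{i,k}]\,(k+1)^\mu,$$ where, for each $i$ and all $k\geq 0$, the $v_{i,k}$ satisfy $$v_{i,k+1}>v_{i,k}\ \text{ implies that }\ v_{i,k+1}\le|g_{i,k+1}|,\qquad\text{and}\qquad v_{i,k}\ge\frac{|g_{i,k}|}{h(k)},$$ for some positive function $h(k)$ only depending on $k$. Then, for any $\eta\in(0,\tau\varsigma_{\min})$ and $$j_\eta=\left(\frac{\kappa_B(\kappa_B+L)}{\theta\varsigma_{\min}(\tau\varsigma_{\min}-\eta)}\right)^{\frac1\nu},$$ there exist a constant $\kappa_\diamond$, a subsequence $\{k_\ell\}\subseteq\{k\}_{j_\eta+1}^\infty$ (i.e. of the iteration indices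 $k\ge j_\eta+1$) and an index $k_\varsigma$, where $\kappa_\diamond$ and $k_\varsigma$ only depend on the problem and the algorithmic constants, such that, for all $k_\ell\ge k_\varsigma$, $$\min_{j\in\{0,\dots,k_\ell\}}\|g_j\|^2\le\kappa_\diamond\frac{(k_\ell+1)^\mu}{k_\ell-j_\eta}\le\frac{2\kappa_\diamond(j_\eta+1)}{k_\ell^{1-\mu}}.$$
   Context: $\|\cdot\|$ is the Euclidean norm (and the induced norm on matrices). For the iterates $x_k$, write $g_k=g(x_k)=\nabla f(x_k)$; $g_{i,k}$, $s_{i,k}$, $w_{i,k}$ denote the $i$-th components of $g_k,s_k,w_k\in\mathbb{R}^n$. ASTR1 algorithm. Given a starting point $x_0\in\mathbb{R}^n$ and constants $\kappa_B\ge1$ and $\tau\in(0,1]$, for $k=0,1,2,\dots$: 1. Compute $g_k$ and define $\Delta_{i,k}=|g_{i,k}|/w_{i,k}$ for $i\in\{1,\dots,n\}$, where the scaling factors $w_{i,k}>0$ depend on $x_0,\dots,x_k$. 2. Select any symmetric matrix $B_k$ with $\|B_k\|\le\kappa_B$. 3. Compute any step $s_k$ such that $|s_{i,k}|\le\Delta_{i,k}$ for all $i\in\{1,\dots,n\}$ and $$g_k^Ts_k+\tfrac12 s_k^TB_ks_k\le\tau\left(g_k^Ts_k^Q+\tfrac12(s_k^Q)^TB_ks_k^Q\right),$$ where $s_{i,k}^L=-\mathrm{sign}(g_{i,k})\Delta_{i,k}$, $s_k^Q=\gamma_ks_k^L$, and $\gamma_k=\min\left[1,\frac{|g_k^Ts_k^L|}{(s_k^L)^TB_ks_k^L}\right]$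 if $(s_k^L)^TB_ks_k^L>0$, $\gamma_k=1$ otherwise. 4. Set $x_{k+1}=x_k+s_k$. The algorithm has no termination rule and generates an infinite sequence. A subsequence is understood to be infinite. *)

theory Defs
  imports "HOL-Analysis.Analysis"
begin

definition model :: "real ^ 'n \<Rightarrow> real ^ 'n ^ 'n \<Rightarrow> real ^ 'n \<Rightarrow> real" where
  "model gk B s = gk \<bullet> s + 1 / 2 * (s \<bullet> (B *v s))"

definition radius :: "real ^ 'n \<Rightarrow> real ^ 'n \<Rightarrow> 'n \<Rightarrow> real" where
  "radius gk w i = \<bar>gk $ i\<bar> / w $ i"

definition step_L :: "real ^ 'n \<Rightarrow> real ^ 'n \<Rightarrow> real ^ 'n" where
  "step_L gk w = (\<chi> i. - sgn (gk $ i) * radius gk w i)"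

definition stepsize_Q :: "real ^ 'n \<Rightarrow> real ^ 'n ^ 'n \<Rightarrow> real ^ 'n \<Rightarrow> real" where
  "stepsize_Q gk B sL =
     (if sL \<bullet> (B *v sL) > 0 then min 1 (\<bar>gk \<bullet> sL\<bar> / (sL \<bullet> (B *v sL))) else 1)"

definition step_Q :: "real ^ 'n \<Rightarrow> real ^ 'n \<Rightarrow> real ^ 'n ^ 'n \<Rightarrow> real ^ 'n" where
  "step_Q gk w B = stepsize_Q gk B (step_L gk w) *\<^sub>R step_L gk w"

definition history :: "(nat \<Rightarrow> 'a) \<Rightarrow> nat \<Rightarrow> 'a list" where
  "history x k = map x [0..<Suc k]"

text \<open>
  \<open>W\<close> is the scaling rule: the scaling factors of iteration \<open>k\<close> are
  \<open>W [x\<^sub>0, \<dots>, x\<^sub>k]\<close>, where the iteration index can be read off the length of the list.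
  The matrix norm is the operator norm \<open>onorm\<close>, since \<open>norm\<close> on the type of matrices is the
  Frobenius norm.
\<close>

definition astr1 ::
  "(real ^ 'n \<Rightarrow> real ^ 'n) \<Rightarrow> real \<Rightarrow> real \<Rightarrow> real ^ 'n \<Rightarrow> ((real ^ 'n) list \<Rightarrow> real ^ 'n) \<Rightarrow>
   (nat \<Rightarrow> real ^ 'n) \<Rightarrow> (nat \<Rightarrow> real ^ 'n ^ 'n) \<Rightarrow> (nat \<Rightarrow> real ^ 'n) \<Rightarrow> bool"
where
  "astr1 g \<kappa>\<^sub>B \<tau> x0 W x B s \<longleftrightarrow>
     x 0 = x0 \<and>
     (\<forall>k. let gk = g (x k); w = W (history x k) in
        (\<forall>i. w $ i > 0) \<and>
        transpose (B k) = B k \<and> onorm (\<lambda>v. B k *v v) \<le> \<kappa>\<^sub>B \<and>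
        (\<forall>i. \<bar>s k $ i\<bar> \<le> radius gk w i) \<and>
        model gk (B k) (s k) \<le> \<tau> * model gk (B k) (step_Q gk w (B k)) \<and>
        x (Suc k) = x k + s k)"

definition scaling_bounds ::
  "real \<Rightarrow> ('n \<Rightarrow> real) \<Rightarrow> real \<Rightarrow> real \<Rightarrow> (nat \<Rightarrow> real ^ 'n) \<Rightarrow> (nat \<Rightarrow> real ^ 'n) \<Rightarrow> bool"
where
  "scaling_bounds \<theta> \<sigma> \<nu> \<mu> v w \<longleftrightarrow>
     (\<forall>i k. \<theta> * max (\<sigma> i) (v k $ i) * real (k + 1) powr \<nu> \<le> w k $ i \<and>
            w k $ i \<le> \<theta> * max (\<sigma> i) (v k $ i) * real (k + 1) powr \<mu>)"

definition v_conditions ::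
  "(nat \<Rightarrow> real) \<Rightarrow> (nat \<Rightarrow> real ^ 'n) \<Rightarrow> (nat \<Rightarrow> real ^ 'n) \<Rightarrow> bool"
where
  "v_conditions h gs v \<longleftrightarrow>
     (\<forall>i k. (v (Suc k) $ i > v k $ i \<longrightarrow> v (Suc k) $ i \<le> \<bar>gs (Suc k) $ i\<bar>) \<and>
            v k $ i \<ge> \<bar>gs k $ i\<bar> / h k)"

definition j_threshold :: "real \<Rightarrow> real \<Rightarrow> real \<Rightarrow> real \<Rightarrow> real \<Rightarrow> real \<Rightarrow> real \<Rightarrow> real" where
  "j_threshold \<kappa>\<^sub>B L \<theta> \<sigma>min \<tau> \<nu> \<eta> =
     (\<kappa>\<^sub>B * (\<kappa>\<^sub>B + L) / (\<theta> * \<sigma>min * (\<tau> * \<sigma>min - \<eta>))) powr (1 / \<nu>)"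

end

theory Submission
  imports Defs "HOL-Real_Asymp.Real_Asymp"
begin

text \<open>
  From some iteration on all scaling factors are so large that the linearised step is not
  truncated and each iteration decreases \<open>f\<close> by at least \<open>\<tau> / 4 * (\<Sum>i. g\<^sub>i\<^sup>2 / w\<^sub>i)\<close>; so these sums are
  summable. Since \<open>f\<close> is eventually decreasing and \<open>\<parallel>g\<parallel>\<^sup>2 \<le> 2 (L + 1) (f - f\<^sub>l\<^sub>o\<^sub>w)\<close>, the gradients
  stay bounded along the trajectory, hence so do the \<open>v\<^sub>i\<close>, and \<open>\<parallel>g\<^sub>k\<parallel>\<^sup>2 / (k + 1)\<^sup>\<mu>\<close> is summable. If
  the first bound failed for all large \<open>k\<close> with \<open>\<kappa> = 1\<close>, these terms would dominate the harmonic
  series. As the subsequence may depend on the trajectory, \<open>\<kappa> = 1\<close> and \<open>k\<^sub>\<varsigma> = 0\<close> are uniform.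
\<close>

section \<open>Descent and gradient bounds for Lipschitz gradients\<close>

text \<open>Subtracting the linear term and the quadratic bound from \<open>f\<close> along the
  segment from \<open>x\<close> to \<open>x + s\<close> leaves \<open>\<phi>\<close>. Its derivative
  on [0, 1] is nonpositive by Cauchy-Schwarz and the Lipschitz bound, and the claim is
  \<open>\<phi> 1 \<le> \<phi> 0\<close>.\<close>

lemma lipschitz_gradient_descent:
  fixes f :: "'a::real_inner \<Rightarrow> real"
  assumes grad: "\<And>x. GDERIV f x :> g x" and lip: "L-lipschitz_on UNIV g"
  shows "f (x + s) \<le> f x + g x \<bullet> s + L / 2 * (norm s)\<^sup>2"
proof -
  define \<phi> where "\<phi> t = f (x + t *\<^sub>R s) - t * (g x \<bullet> s) - L / 2 * t\<^sup>2 * (norm s)\<^sup>2" for t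
  have deriv: "(\<phi> has_real_derivative (g (x + t *\<^sub>R s) - g x) \<bullet> s - L * t * (norm s)\<^sup>2) (at t)" for t
  proof -
    have F: "(f has_derivative (\<lambda>h. h \<bullet> g (x + t *\<^sub>R s))) (at (x + t *\<^sub>R s))"
      using grad by (simp add: gderiv_def)
    have "((\<lambda>t. x + t *\<^sub>R s) has_derivative (\<lambda>h. h *\<^sub>R s)) (at t)"
      by (auto intro!: derivative_eq_intros)
    from has_derivative_compose[OF this F]
    have "((\<lambda>t. f (x + t *\<^sub>R s)) has_real_derivative s \<bullet> g (x + t *\<^sub>R s)) (at t)"
      by (simp add: has_field_derivative_def mult_commute_abs)
    then show ?thesis
      unfolding \<phi>_def
      by (auto intro!: derivative_eq_intros simp: inner_diff_right inner_commute)
  qed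
  have "\<phi> 1 \<le> \<phi> 0"
  proof (rule DERIV_nonpos_imp_nonincreasing[where f = \<phi>])
    fix t :: real assume t: "0 \<le> t" "t \<le> 1"
    have "(g (x + t *\<^sub>R s) - g x) \<bullet> s \<le> norm (g (x + t *\<^sub>R s) - g x) * norm s"
      by (rule norm_cauchy_schwarz)
    also have "\<dots> \<le> (L * dist (x + t *\<^sub>R s) x) * norm s"
      using lipschitz_onD[OF lip, of "x + t *\<^sub>R s" x] by (intro mult_right_mono) (auto simp: dist_norm)
    also have "\<dots> = L * t * (norm s)\<^sup>2"
      using t by (simp add: dist_norm power2_eq_square)
    finally show "\<exists>y. (\<phi> has_real_derivative y) (at t) \<and> y \<le> 0"
      using deriv[of t] by auto
  qed simp
  then show ?thesis by (simp add: \<phi>_def)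
qed

text \<open>A gradient step of length \<open>1 / (L + 1)\<close> lowers \<open>f\<close> by a
  multiple of the squared gradient norm, yet cannot pass below \<open>flow\<close>. Using
  \<open>L + 1\<close> instead of \<open>L\<close> covers the case \<open>L = 0\<close>.\<close>

lemma lipschitz_gradient_norm_bound:
  fixes f :: "'a::real_inner \<Rightarrow> real"
  assumes grad: "\<And>x. GDERIV f x :> g x" and lip: "L-lipschitz_on UNIV g"
    and low: "\<And>x. f x \<ge> flow"
  shows "(norm (g x))\<^sup>2 \<le> 2 * (L + 1) * (f x - flow)"
proof -
  have L: "L \<ge> 0" using lip by (rule lipschitz_on_nonneg)
  define a where "a = 1 / (L + 1)"
  have a: "a > 0" and La: "L * a \<le> 1" using L by (auto simp: a_def)
  have "flow \<le> f (x + (- a) *\<^sub>R g x)" by (rule low)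
  also have "\<dots> \<le> f x + g x \<bullet> ((- a) *\<^sub>R g x) + L / 2 * (norm ((- a) *\<^sub>R g x))\<^sup>2"
    by (rule lipschitz_gradient_descent[OF grad lip])
  \<comment> \<open>The quadratic term is grouped so that \<open>L * a \<le> 1\<close> makes it
    cancel at most half of the linear gain.\<close>
  also have "\<dots> = f x - a * (norm (g x))\<^sup>2 + (L * a) * (a / 2 * (norm (g x))\<^sup>2)"
    using a by (simp add: power_mult_distrib dot_square_norm power2_eq_square)
  also have "\<dots> \<le> f x - a * (norm (g x))\<^sup>2 + 1 * (a / 2 * (norm (g x))\<^sup>2)"
    using a La by (intro add_left_mono mult_right_mono) auto
  finally have "a * (norm (g x))\<^sup>2 \<le> 2 * (f x - flow)" by simp
  then show ?thesis using L by (simp add: a_def field_simps)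
qed

section \<open>Estimates for a single step\<close>

lemma abs_quadratic_form_le_onorm:
  fixes B :: "real ^ 'n ^ 'n"
  assumes "onorm (\<lambda>v. B *v v) \<le> \<kappa>"
  shows "\<bar>s \<bullet> (B *v s)\<bar> \<le> \<kappa> * (norm s)\<^sup>2"
proof -
  have "\<bar>s \<bullet> (B *v s)\<bar> \<le> norm s * norm (B *v s)" by (rule Cauchy_Schwarz_ineq2)
  also have "norm (B *v s) \<le> onorm (\<lambda>v. B *v v) * norm s"
    by (rule onorm) (rule matrix_vector_mul_bounded_linear)
  also have "\<dots> \<le> \<kappa> * norm s" using assms by (intro mult_right_mono) auto
  finally show ?thesis
    by (simp add: power2_eq_square mult_left_mono mult.left_commute)
qed

lemma norm_power2_eq_sum: "(norm (x :: real ^ 'n))\<^sup>2 = (\<Sum>i\<in>UNIV. (x $ i)\<^sup>2)"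
  by (simp add: norm_vec_def L2_set_def sum_nonneg)

text \<open>Squaring the radius gives two factors \<open>1 / w $ i\<close>; one is bounded by
  \<open>1 / c\<close>, the other stays in the sum. This serves both the linearised step and the
  actual step.\<close>

lemma norm_le_radius:
  fixes gk w s :: "real ^ 'n"
  assumes c: "c > 0" "\<And>i. w $ i \<ge> c" and s: "\<And>i. \<bar>s $ i\<bar> \<le> radius gk w i"
  shows "(norm s)\<^sup>2 \<le> (\<Sum>i\<in>UNIV. (gk $ i)\<^sup>2 / w $ i) / c"
  unfolding norm_power2_eq_sum sum_divide_distrib
proof (rule sum_mono)
  fix i
  have w: "w $ i > 0" using c(1) c(2)[of i] by linarith
  have "(s $ i)\<^sup>2 \<le> (radius gk w i)\<^sup>2"
    using s[of i] by (metis abs_ge_zero power2_abs power_mono)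
  also have "\<dots> = (gk $ i)\<^sup>2 / w $ i / w $ i"
    by (simp add: radius_def power_divide power2_eq_square)
  also have "\<dots> \<le> (gk $ i)\<^sup>2 / w $ i / c"
    using w c by (intro divide_left_mono) auto
  finally show "(s $ i)\<^sup>2 \<le> (gk $ i)\<^sup>2 / w $ i / c" .
qed

lemma model_step_Q_le:
  fixes gk w :: "real ^ 'n"
  assumes c: "c \<ge> \<kappa>" "\<kappa> > 0" "\<And>i. w $ i \<ge> c" and B: "onorm (\<lambda>v. B *v v) \<le> \<kappa>"
  shows "model gk B (step_Q gk w B) \<le> - (\<Sum>i\<in>UNIV. (gk $ i)\<^sup>2 / w $ i) / 2"
proof -
  define S where "S = (\<Sum>i\<in>UNIV. (gk $ i)\<^sup>2 / w $ i)"
  have c0: "c > 0" using c by linarith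
  have w: "w $ i > 0" for i using c0 c(3)[of i] by linarith
  have S0: "S \<ge> 0" unfolding S_def using w by (intro sum_nonneg) (simp add: less_imp_le)
  have gs: "gk \<bullet> step_L gk w = - S"
    unfolding S_def inner_vec_def sum_negf[symmetric]
    by (rule sum.cong) (simp_all add: step_L_def radius_def power2_eq_square sgn_if)
  have "(norm (step_L gk w))\<^sup>2 \<le> S / c"
    unfolding S_def using c0 c(3)
  proof (rule norm_le_radius)
    fix i show "\<bar>step_L gk w $ i\<bar> \<le> radius gk w i"
      using w[of i] by (simp add: step_L_def radius_def abs_mult sgn_if)
  qed
  then have "\<kappa> * (norm (step_L gk w))\<^sup>2 \<le> \<kappa> * (S / c)" using c by (intro mult_left_mono) auto
  also have "\<dots> \<le> S" using c c0 mult_left_mono[OF c(1) S0] by (simp add: field_simps)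
  finally have curv: "step_L gk w \<bullet> (B *v step_L gk w) \<le> S"
    using abs_quadratic_form_le_onorm[OF B, of "step_L gk w"] by linarith
  \<comment> \<open>The curvature along the linearised step is at most its slope, so the step is not truncated.\<close>
  have "stepsize_Q gk B (step_L gk w) = 1"
    using curv S0 by (auto simp: stepsize_Q_def gs min_def field_simps)
  \<comment> \<open>The full step has slope \<open>- S\<close> and half its curvature is at most
    \<open>S / 2\<close>.\<close>
  then show ?thesis
    using curv by (simp add: step_Q_def model_def gs flip: S_def)
qed

text \<open>The actual step achieves a model decrease of at least \<open>\<tau> * S / 2\<close>,
  while \<open>f\<close> exceeds its model by at most \<open>(L + \<kappa>) / 2\<close> times the
  squared step norm. The threshold on the weights is chosen so that this error uses up no more than
  half of the decrease.\<close>

lemma astr1_sufficient_decrease: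
  fixes f :: "real ^ 'n \<Rightarrow> real"
  assumes grad: "\<And>x. GDERIV f x :> g x" and lip: "L-lipschitz_on UNIV g"
    and \<kappa>: "\<kappa> > 0" and tau: "0 < \<tau>" "\<tau> \<le> 1"
    and w: "\<And>i. w $ i \<ge> 2 * (L + \<kappa>) / \<tau>"
    and B: "onorm (\<lambda>v. B *v v) \<le> \<kappa>"
    and s: "\<And>i. \<bar>s $ i\<bar> \<le> radius (g x) w i"
    and dec: "model (g x) B s \<le> \<tau> * model (g x) B (step_Q (g x) w B)"
  shows "f (x + s) \<le> f x - \<tau> / 4 * (\<Sum>i\<in>UNIV. (g x $ i)\<^sup>2 / w $ i)"
proof -
  define c where "c = 2 * (L + \<kappa>) / \<tau>"
  define S where "S = (\<Sum>i\<in>UNIV. (g x $ i)\<^sup>2 / w $ i)"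
  have L: "L \<ge> 0" using lip by (rule lipschitz_on_nonneg)
  have c0: "c > 0" using L \<kappa> tau by (simp add: c_def)
  \<comment> \<open>Since \<open>\<tau> \<le> 1\<close>, the threshold \<open>c\<close> is also at
    least \<open>\<kappa>\<close>, as the model estimate requires.\<close>
  have "\<kappa> * \<tau> \<le> \<kappa> * 1" using tau \<kappa> by (intro mult_left_mono) auto
  then have "\<kappa> * \<tau> \<le> 2 * (L + \<kappa>)" using L \<kappa> unfolding mult_1_right distrib_left by linarith
  then have c: "c \<ge> \<kappa>" using tau by (simp add: c_def pos_le_divide_eq)
  have wc: "w $ i \<ge> c" for i using w by (simp add: c_def)
  have m: "model (g x) B s \<le> - \<tau> * S / 2"
  proof -
    have "model (g x) B (step_Q (g x) w B) \<le> - S / 2"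
      unfolding S_def by (rule model_step_Q_le[OF c \<kappa> wc B])
    from mult_left_mono[OF this, of \<tau>] tau dec show ?thesis by simp
  qed
  have "(L + \<kappa>) / 2 * (norm s)\<^sup>2 \<le> (L + \<kappa>) / 2 * (S / c)"
    unfolding S_def using L \<kappa> by (intro mult_left_mono norm_le_radius[OF c0 wc s]) auto
  also have "\<dots> = \<tau> / 4 * S"
    using L \<kappa> tau by (simp add: c_def field_simps add_nonneg_pos)
  finally have n: "(L + \<kappa>) / 2 * (norm s)\<^sup>2 \<le> \<tau> / 4 * S" .
  \<comment> \<open>The model may contain negative curvature that \<open>f\<close> lacks; this
    contributes the \<open>\<kappa> / 2\<close> part of the error, and the descent lemma the
    \<open>L / 2\<close> part.\<close>
  have "- (s \<bullet> (B *v s)) \<le> \<kappa> * (norm s)\<^sup>2"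
    using abs_quadratic_form_le_onorm[OF B, of s] by linarith
  then have "f (x + s) \<le> f x + model (g x) B s + (L + \<kappa>) / 2 * (norm s)\<^sup>2"
    using lipschitz_gradient_descent[OF grad lip, of x s]
    by (simp add: model_def field_simps)
  with m n show ?thesis unfolding S_def[symmetric] by linarith
qed

section \<open>Boundedness of the \<open>v\<close> sequence and facts on real sequences\<close>

text \<open>A component of \<open>v\<close> can rise only to a value below the current gradient
  component, so no rise goes beyond \<open>G\<close>.\<close>

lemma v_conditions_bounded:
  assumes v: "v_conditions h gs v" and G: "\<And>k. norm (gs k) \<le> G"
  shows "v k $ i \<le> max (v 0 $ i) G"
proof (induction k)
  case (Suc k)
  have "v (Suc k) $ i \<le> v k $ i \<or> v (Suc k) $ i \<le> \<bar>gs (Suc k) $ i\<bar>"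
    using v unfolding v_conditions_def by (meson not_le)
  moreover have "\<bar>gs (Suc k) $ i\<bar> \<le> G"
    using component_le_norm_cart G order_trans by blast
  ultimately show ?case using Suc by linarith
qed simp

text \<open>From \<open>K\<close> on the partial sums telescope and are bounded by
  \<open>\<phi> K - b\<close>; finitely many earlier terms do not affect summability.\<close>

lemma summable_if_eventually_bounded_by_decrease:
  fixes a \<phi> :: "nat \<Rightarrow> real"
  assumes nonneg: "\<And>k. a k \<ge> 0" and low: "\<And>k. \<phi> k \<ge> b"
    and dec: "\<And>k. k \<ge> K \<Longrightarrow> \<phi> (Suc k) \<le> \<phi> k - a k"
  shows "summable a"
proof -
  have partial: "(\<Sum>k<n. a (k + K)) \<le> \<phi> K - \<phi> (n + K)" for n
  proof (induction n)
    case (Suc n) then show ?case using dec[of "n + K"] by simp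
  qed simp
  have "(\<Sum>k<n. a (k + K)) \<le> \<phi> K - b" for n
    using partial[of n] low[of "n + K"] by linarith
  then have "summable (\<lambda>k. a (k + K))" using nonneg by (intro summableI_nonneg_bounded)
  then show ?thesis by simp
qed

lemma frequently_less_harmonic:
  fixes a :: "nat \<Rightarrow> real"
  assumes "summable a"
  shows "\<exists>\<^sub>F k in sequentially. a k < 1 / real k"
proof (rule ccontr)
  assume "\<not> ?thesis"
  then have "\<forall>\<^sub>F k in sequentially. norm (1 / real k) \<le> a k"
    by (simp add: not_frequently not_less)
  then have "summable (\<lambda>k. 1 / real k)" using assms by (rule summable_comparison_test_ev)
  then show False
    using not_summable_harmonic[where 'a = real] by (simp add: inverse_eq_divide)
qed

text \<open>This yields the second inequality of the theorem. The factor 2 comes from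
  \<open>k + 1 \<le> 2 * k\<close> and \<open>\<mu> \<le> 1\<close>.\<close>

lemma powr_ratio_le:
  fixes k j \<mu> :: real
  assumes "0 \<le> j" "j + 1 \<le> k" "0 \<le> \<mu>" "\<mu> \<le> 1"
  shows "(k + 1) powr \<mu> / (k - j) \<le> 2 * (j + 1) / k powr (1 - \<mu>)"
proof -
  have k: "k \<ge> 1" using assms by linarith
  have "(k + 1) powr \<mu> \<le> (2 * k) powr \<mu>" using k assms by (intro powr_mono2) auto
  also have "\<dots> = 2 powr \<mu> * k powr \<mu>" using k by (simp add: powr_mult)
  also have "\<dots> \<le> 2 powr 1 * k powr \<mu>" using assms by (intro mult_right_mono powr_mono) auto
  finally have "(k + 1) powr \<mu> * k powr (1 - \<mu>) \<le> 2 * k powr \<mu> * k powr (1 - \<mu>)"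
    by (intro mult_right_mono) auto
  also have "\<dots> = 2 * k" using k by (simp add: powr_diff)
  \<comment> \<open>The factor \<open>j + 1\<close> pays for replacing \<open>k\<close> by
    \<open>k - j\<close>: the difference of the two sides is twice
    \<open>j * (k - j - 1)\<close>.\<close>
  also have "\<dots> \<le> 2 * ((j + 1) * (k - j))"
  proof -
    have "0 \<le> j * (k - j - 1)" using assms by auto
    then show ?thesis by (simp add: algebra_simps)
  qed
  finally show ?thesis using assms k by (simp add: field_simps)
qed

section \<open>Summability along a trajectory\<close>

lemma astr1_weighted_gradients_summable:
  fixes f :: "real ^ 'n \<Rightarrow> real"
  assumes grad: "\<And>x. GDERIV f x :> g x" and lip: "L-lipschitz_on UNIV g"
    and low: "\<And>x. f x \<ge> flow"
    and \<kappa>: "\<kappa> > 0" and tau: "0 < \<tau>" "\<tau> \<le> 1" and nu: "0 < \<nu>" and theta: "\<theta> > 0"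
    and sigma: "\<And>i. 0 < \<sigma> i" "\<And>i. \<sigma> i \<le> 1"
    and run: "astr1 g \<kappa> \<tau> x0 W x B s"
    and scal: "scaling_bounds \<theta> \<sigma> \<nu> \<mu> v (\<lambda>k. W (history x k))"
    and vc: "v_conditions h (\<lambda>k. g (x k)) v"
  shows "summable (\<lambda>k. (norm (g (x k)))\<^sup>2 / real (k + 1) powr \<mu>)"
proof -
  define w where "w k = W (history x k)" for k
  define S where "S k = (\<Sum>i\<in>UNIV. (g (x k) $ i)\<^sup>2 / w k $ i)" for k
  have L: "L \<ge> 0" using lip by (rule lipschitz_on_nonneg)
  have step: "(\<forall>i. w k $ i > 0)" "onorm (\<lambda>v. B k *v v) \<le> \<kappa>"
      "\<forall>i. \<bar>s k $ i\<bar> \<le> radius (g (x k)) (w k) i"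
      "model (g (x k)) (B k) (s k) \<le> \<tau> * model (g (x k)) (B k) (step_Q (g (x k)) (w k) (B k))"
      "x (Suc k) = x k + s k" for k
    using run by (auto simp: astr1_def Let_def w_def)
  have lower: "\<theta> * max (\<sigma> i) (v k $ i) * real (k + 1) powr \<nu> \<le> w k $ i"
    and upper: "w k $ i \<le> \<theta> * max (\<sigma> i) (v k $ i) * real (k + 1) powr \<mu>" for i k
    using scal by (auto simp: scaling_bounds_def w_def)
  have S0: "S k \<ge> 0" for k
    unfolding S_def using step(1) by (intro sum_nonneg) (simp add: less_imp_le)

  \<comment> \<open>The lower scaling bound is at least
    \<open>\<theta> * \<sigma> i * real (k + 1) powr \<nu>\<close>, which tends to infinity because
    \<open>\<nu> > 0\<close>.\<close>
  have "\<forall>\<^sub>F k in sequentially. 2 * (L + \<kappa>) / \<tau> \<le> w k $ i" for i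
  proof -
    have "filterlim (\<lambda>k. real (k + 1) powr \<nu>) at_top sequentially"
      using nu by real_asymp
    then have "\<forall>\<^sub>F k in sequentially. 2 * (L + \<kappa>) / \<tau> / (\<theta> * \<sigma> i) \<le> real (k + 1) powr \<nu>"
      by (simp add: filterlim_at_top)
    then show ?thesis
    proof eventually_elim
      case (elim k)
      have "2 * (L + \<kappa>) / \<tau> \<le> \<theta> * \<sigma> i * real (k + 1) powr \<nu>"
        using elim theta sigma(1)[of i]
        by (subst (asm) pos_divide_le_eq) (auto simp: mult.commute)
      also have "\<dots> \<le> \<theta> * max (\<sigma> i) (v k $ i) * real (k + 1) powr \<nu>"
        using theta by (intro mult_right_mono mult_left_mono) auto
      finally show ?case using lower[of i k] by linarith
    qed
  qed
  then have "\<forall>\<^sub>F k in sequentially. \<forall>i. 2 * (L + \<kappa>) / \<tau> \<le> w k $ i"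
    by (intro eventually_all_finite)
  then obtain K where K: "\<And>k i. k \<ge> K \<Longrightarrow> 2 * (L + \<kappa>) / \<tau> \<le> w k $ i"
    by (auto simp: eventually_sequentially)
  have dec: "f (x (Suc k)) \<le> f (x k) - \<tau> / 4 * S k" if "k \<ge> K" for k
    unfolding S_def step(5)
    by (rule astr1_sufficient_decrease[OF grad lip \<kappa> tau K[OF that] step(2) _ step(4)])
      (use step in auto)
  have "summable (\<lambda>k. \<tau> / 4 * S k)"
    using S0 tau low dec
    by (intro summable_if_eventually_bounded_by_decrease[where \<phi> = "\<lambda>k. f (x k)" and b = flow]) auto
  then have sumS: "summable S" using tau by simp

  \<comment> \<open>Before \<open>K\<close> the values of \<open>f\<close> may increase, so their
    maximum is taken; from \<open>K\<close> on they do not increase.\<close>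
  define F where "F = Max ((\<lambda>k. f (x k)) ` {..K})"
  have F: "f (x k) \<le> F" for k
  proof (induction k)
    case (Suc k)
    show ?case
    proof (cases "Suc k \<le> K")
      case False
      have "0 \<le> \<tau> / 4 * S k" using S0 tau by simp
      with dec[of k] Suc False show ?thesis by linarith
    qed (auto simp: F_def)
  qed (auto simp: F_def)
  define G where "G = sqrt (2 * (L + 1) * (F - flow))"
  have G: "norm (g (x k)) \<le> G" for k
    unfolding G_def
  proof (rule real_le_rsqrt)
    have "(norm (g (x k)))\<^sup>2 \<le> 2 * (L + 1) * (f (x k) - flow)"
      by (rule lipschitz_gradient_norm_bound[OF grad lip low])
    also have "\<dots> \<le> 2 * (L + 1) * (F - flow)"
      using F[of k] L by (intro mult_left_mono) auto
    finally show "(norm (g (x k)))\<^sup>2 \<le> 2 * (L + 1) * (F - flow)" .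
  qed
  \<comment> \<open>The entry 1 dominates every \<open>\<sigma> i\<close>, so \<open>V\<close>
    bounds all the factors \<open>max (\<sigma> i) (v k $ i)\<close>.\<close>
  define V where "V = Max (range (\<lambda>i. max 1 (max (v 0 $ i) G)))"
  have V: "max 1 (max (v 0 $ i) G) \<le> V" for i unfolding V_def by (rule Max_ge) auto
  have V0: "V > 0" using V[of undefined] by linarith
  have wV: "w k $ i \<le> \<theta> * V * real (k + 1) powr \<mu>" for i k
  proof -
    have "max (\<sigma> i) (v k $ i) \<le> V"
      using V[of i] sigma(2)[of i] v_conditions_bounded[OF vc G, of k i] by linarith
    then have "\<theta> * max (\<sigma> i) (v k $ i) * real (k + 1) powr \<mu> \<le> \<theta> * V * real (k + 1) powr \<mu>"
      using theta by (intro mult_right_mono mult_left_mono) auto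
    with upper[of k i] show ?thesis by linarith
  qed
  \<comment> \<open>By \<open>wV\<close>, \<open>1 / real (k + 1) powr \<mu>\<close> is at most
    \<open>\<theta> * V / w k $ i\<close>, so the comparison holds term by term.\<close>
  have "(norm (g (x k)))\<^sup>2 / real (k + 1) powr \<mu> \<le> \<theta> * V * S k" for k
    unfolding norm_power2_eq_sum sum_divide_distrib S_def sum_distrib_left
  proof (rule sum_mono)
    fix i
    have "(g (x k) $ i)\<^sup>2 * w k $ i \<le> (g (x k) $ i)\<^sup>2 * (\<theta> * V * real (k + 1) powr \<mu>)"
      using wV by (intro mult_left_mono) auto
    then show "(g (x k) $ i)\<^sup>2 / real (k + 1) powr \<mu> \<le> \<theta> * V * ((g (x k) $ i)\<^sup>2 / w k $ i)"
      using step(1)[of k] by (simp add: field_simps)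
  qed
  then show ?thesis
    by (intro summable_comparison_test'[OF summable_mult[OF sumS, of "\<theta> * V"]]) auto
qed

section \<open>The convergence rate along a subsequence\<close>

theorem theorem4p2:
  fixes f :: "real ^ 'n \<Rightarrow> real"
    and g :: "real ^ 'n \<Rightarrow> real ^ 'n"
    and x0 :: "real ^ 'n"
    and \<sigma> :: "'n \<Rightarrow> real"
    and h :: "nat \<Rightarrow> real"
    and L flow \<kappa>\<^sub>B \<tau> \<nu> \<mu> \<theta> \<sigma>min \<eta> j\<eta> :: real
  assumes grad: "\<And>x. GDERIV f x :> g x"
    and cont: "continuous_on UNIV g"
    and lip: "L-lipschitz_on UNIV g"
    and bounded_below: "\<And>x. f x \<ge> flow"
    and kappaB: "\<kappa>\<^sub>B \<ge> 1"
    and tau: "0 < \<tau>" "\<tau> \<le> 1"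
    and nu_mu: "0 < \<nu>" "\<nu> \<le> \<mu>" "\<mu> < 1"
    and theta: "\<theta> > 0"
    and sigma: "\<And>i. 0 < \<sigma> i" "\<And>i. \<sigma> i \<le> 1"
    and sigma_min: "\<sigma>min = Min (range \<sigma>)"
    and h_pos: "\<And>k. h k > 0"
    and eta: "0 < \<eta>" "\<eta> < \<tau> * \<sigma>min"
    and j_eta: "j\<eta> = j_threshold \<kappa>\<^sub>B L \<theta> \<sigma>min \<tau> \<nu> \<eta>"
  shows "\<exists>(\<kappa>d :: real) (k\<sigma> :: nat).
    \<forall>(W :: (real ^ 'n) list \<Rightarrow> real ^ 'n) (v :: nat \<Rightarrow> real ^ 'n)
      (x :: nat \<Rightarrow> real ^ 'n) (B :: nat \<Rightarrow> real ^ 'n ^ 'n) (s :: nat \<Rightarrow> real ^ 'n).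
      astr1 g \<kappa>\<^sub>B \<tau> x0 W x B s \<and>
      scaling_bounds \<theta> \<sigma> \<nu> \<mu> v (\<lambda>k. W (history x k)) \<and>
      v_conditions h (\<lambda>k. g (x k)) v \<longrightarrow>
      (\<exists>kl :: nat \<Rightarrow> nat. strict_mono kl \<and> (\<forall>l. real (kl l) \<ge> j\<eta> + 1) \<and>
        (\<forall>l. kl l \<ge> k\<sigma> \<longrightarrow>
          (MIN j\<in>{0..kl l}. (norm (g (x j)))\<^sup>2)
            \<le> \<kappa>d * (real (kl l + 1) powr \<mu> / (real (kl l) - j\<eta>)) \<and>
          \<kappa>d * (real (kl l + 1) powr \<mu> / (real (kl l) - j\<eta>))
            \<le> 2 * \<kappa>d * (j\<eta> + 1) / real (kl l) powr (1 - \<mu>)))"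
proof (intro exI[of _ "1::real"] exI[of _ "0::nat"] allI impI, elim conjE)
  fix W :: "(real ^ 'n) list \<Rightarrow> real ^ 'n" and v x s :: "nat \<Rightarrow> real ^ 'n"
    and B :: "nat \<Rightarrow> real ^ 'n ^ 'n"
  assume run: "astr1 g \<kappa>\<^sub>B \<tau> x0 W x B s"
    and scal: "scaling_bounds \<theta> \<sigma> \<nu> \<mu> v (\<lambda>k. W (history x k))"
    and vc: "v_conditions h (\<lambda>k. g (x k)) v"
  \<comment> \<open>A real \<open>powr\<close> is nonnegative whatever its base.\<close>
  have j0: "j\<eta> \<ge> 0" by (simp add: j_eta j_threshold_def)
  define good where "good k \<longleftrightarrow> real k \<ge> j\<eta> + 1 \<and>
    (norm (g (x k)))\<^sup>2 / real (k + 1) powr \<mu> < 1 / real k" for k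
  have "summable (\<lambda>k. (norm (g (x k)))\<^sup>2 / real (k + 1) powr \<mu>)"
    using kappaB
    by (intro astr1_weighted_gradients_summable[OF grad lip bounded_below _ tau nu_mu(1) theta sigma
          run scal vc]) auto
  moreover have "\<forall>\<^sub>F k in sequentially. j\<eta> + 1 \<le> real k"
    by real_asymp
  \<comment> \<open>The harmonic inequality holds infinitely often and the index bound eventually,
    so both hold together infinitely often.\<close>
  ultimately have "\<exists>\<^sub>F k in sequentially. good k"
    unfolding good_def
    by (intro frequently_eventually_conj frequently_less_harmonic)
  then have inf: "infinite {k. good k}"
    by (simp add: cofinite_eq_sequentially[symmetric] frequently_cofinite)
  define kl where "kl = enumerate {k. good k}"
  have kl: "strict_mono kl" "\<And>l. good (kl l)"
    using strict_mono_enumerate[OF inf] enumerate_in_set[OF inf] by (auto simp: kl_def)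
  have bound: "(MIN j\<in>{0..k}. (norm (g (x j)))\<^sup>2) \<le> real (k + 1) powr \<mu> / (real k - j\<eta>)"
    if "good k" for k
  proof -
    have k: "real k \<ge> j\<eta> + 1" and lt: "(norm (g (x k)))\<^sup>2 / real (k + 1) powr \<mu> < 1 / real k"
      using that by (auto simp: good_def)
    have "(MIN j\<in>{0..k}. (norm (g (x j)))\<^sup>2) \<le> (norm (g (x k)))\<^sup>2" by (rule Min_le) auto
    also have "\<dots> \<le> real (k + 1) powr \<mu> / real k" using lt by (simp add: field_simps)
    \<comment> \<open>The denominator shrinks since \<open>j\<eta> \<ge> 0\<close>, and stays at
      least 1 for good indices.\<close>
    also have "\<dots> \<le> real (k + 1) powr \<mu> / (real k - j\<eta>)"
      using k j0 by (intro divide_left_mono) auto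
    finally show ?thesis .
  qed
  have "(\<forall>l. real (kl l) \<ge> j\<eta> + 1)" using kl(2) by (auto simp: good_def)
  moreover have "real (kl l + 1) powr \<mu> / (real (kl l) - j\<eta>)
      \<le> 2 * (j\<eta> + 1) / real (kl l) powr (1 - \<mu>)" for l
    using powr_ratio_le[of j\<eta> "real (kl l)" \<mu>] j0 kl(2)[of l] nu_mu
    by (simp add: good_def add.commute)
  ultimately show "\<exists>kl :: nat \<Rightarrow> nat. strict_mono kl \<and> (\<forall>l. real (kl l) \<ge> j\<eta> + 1) \<and>
        (\<forall>l. kl l \<ge> 0 \<longrightarrow>
          (MIN j\<in>{0..kl l}. (norm (g (x j)))\<^sup>2)
            \<le> 1 * (real (kl l + 1) powr \<mu> / (real (kl l) - j\<eta>)) \<and>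
          1 * (real (kl l + 1) powr \<mu> / (real (kl l) - j\<eta>))
            \<le> 2 * 1 * (j\<eta> + 1) / real (kl l) powr (1 - \<mu>))"
    using kl bound by (intro exI[of _ kl]) auto
qed

end
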